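(* Let $\mu\in\mathcal{P}(\Theta)$ and let $\Phi_1,\Phi_2\in L^0(\Theta,\mathbb{R})$ be such that $\mu_{\Phi_i}\in\mathcal{P}(\Theta)$ for $i=1,2$. (i) If in addition $\Phi_i\in L^1_\mu(\Theta,\mathbb{R}_{\geq 0})$ for $i=1,2$, then $$d_{\mathrm{TV}}(\mu_{\Phi_1},\mu_{\Phi_2})\leq \frac12\,\frac{1}{Z_{\Phi_1,\mu}\wedge Z_{\Phi_2,\mu}}\left\Vert \Phi_1-\Phi_2+\log\frac{Z_{\Phi_1,\mu}}{Z_{\Phi_2,\mu}}\right\Vert_{L^1_\mu}.$$ (ii) If in addition $\Phi_i\in L^\infty_\mu(\Theta,\mathbb{R})$ for $i=1,2$, then $$d_{\mathrm{TV}}(\mu_{\Phi_1},\mu_{\Phi_2})\geq \frac12\left(\frac{\exp(-\Vert\Phi_1\Vert_{L^\infty_\mu})}{Z_{\Phi_1,\mu}}\wedge\frac{\exp(-\Vert\Phi_2\Vert_{L^\infty_\mu})}{Z_{\Phi_2,\mu}}\right)\left\Vert \Phi_1-\Phi_2+\log\frac{Z_{\Phi_1,\mu}}{Z_{\Phi_2,\mu}}\right\Vert_{L^1_\mu}.$$ If $\Phi_1-\Phi_2$ is $\mu$-a.s. constant, then equality holds in both the upper bound in (i) and the lower bound in (ii).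
   Context: $(\Theta,\Sigma)$ is a measurable space and $\mathcal{P}(\Theta)$ is the set of probability measures on it. For $I\subset\mathbb{R}$, $L^0(\Theta,I)$ is the set of $\Sigma$-measurable functions $\Theta\to I$, and $L^p_\mu(\Theta,I)$, $p\in[1,\infty]$, is the set of those with finite $L^p(\mu)$-norm. For $\Phi\in L^0(\Theta,\mathbb{R})$ and $\mu\in\mathcal{P}(\Theta)$: $Z_{\Phi,\mu}:=\int e^{-\Phi}\,\mathrm{d}\mu$; if $0<Z_{\Phi,\mu}<\infty$, then $\mu_\Phi$ is the measure with $\frac{\mathrm{d}\mu_\Phi}{\mathrm{d}\mu}=\ell_{\Phi,\mu}:=e^{-\Phi}/Z_{\Phi,\mu}$. The requirement $\mu_\Phi\in\mathcal{P}(\Theta)$ means $0<Z_{\Phi,\mu}<\infty$. The total variation metric is $d_{\mathrm{TV}}(\mu_1,\mu_2):=\sup_{A\in\Sigma}|\mu_1(A)-\mu_2(A)|=\frac12\int\left|\frac{\mathrm{d}\mu_1}{\mathrm{d}\nu}-\frac{\mathrm{d}\mu_2}{\mathrm{d}\nu}\right|\mathrm{d}\nu$ for any $\nu\in\mathcal{P}(\Theta)$ with $\mu_1,\mu_2\ll\nu$. $a\wedge b:=\min\{a,b\}$. *)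

theory Defs
  imports "HOL-Probability.Probability" "HOL-Probability.Essential_Supremum"
begin

text \<open>
  A measurable space is given by a measure whose \<open>emeasure\<close> is irrelevant; the probability
  measures on it are \<open>space (prob_algebra M)\<close>.  Norms and normalising constants take values
  in \<open>[0, \<infinity>]\<close>, so that finiteness is a genuine condition.
\<close>

definition L0 :: "'a measure \<Rightarrow> real set \<Rightarrow> ('a \<Rightarrow> real) set" where
  "L0 M I = {f \<in> borel_measurable M. \<forall>x\<in>space M. f x \<in> I}"

definition L1_norm :: "'a measure \<Rightarrow> ('a \<Rightarrow> real) \<Rightarrow> ennreal" where
  "L1_norm \<mu> f = (\<integral>\<^sup>+x. ennreal \<bar>f x\<bar> \<partial>\<mu>)"

definition Linf_norm :: "'a measure \<Rightarrow> ('a \<Rightarrow> real) \<Rightarrow> ennreal" where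
  "Linf_norm \<mu> f = esssup \<mu> (\<lambda>x. ennreal \<bar>f x\<bar>)"

definition L1 :: "'a measure \<Rightarrow> real set \<Rightarrow> ('a \<Rightarrow> real) set" where
  "L1 \<mu> I = {f \<in> L0 \<mu> I. L1_norm \<mu> f < \<infinity>}"

definition Linf :: "'a measure \<Rightarrow> real set \<Rightarrow> ('a \<Rightarrow> real) set" where
  "Linf \<mu> I = {f \<in> L0 \<mu> I. Linf_norm \<mu> f < \<infinity>}"

definition Z :: "('a \<Rightarrow> real) \<Rightarrow> 'a measure \<Rightarrow> ennreal" where
  "Z \<Phi> \<mu> = (\<integral>\<^sup>+x. ennreal (exp (- \<Phi> x)) \<partial>\<mu>)"

text \<open>The measure \<open>\<mu>\<^sub>\<Phi>\<close>; meaningful only if \<open>0 < Z \<Phi> \<mu> < \<infinity>\<close>.\<close>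

definition tilted :: "'a measure \<Rightarrow> ('a \<Rightarrow> real) \<Rightarrow> 'a measure" where
  "tilted \<mu> \<Phi> = density \<mu> (\<lambda>x. ennreal (exp (- \<Phi> x)) / Z \<Phi> \<mu>)"

definition d_TV :: "'a measure \<Rightarrow> 'a measure \<Rightarrow> real" where
  "d_TV \<mu>\<^sub>1 \<mu>\<^sub>2 = (SUP A\<in>sets \<mu>\<^sub>1. \<bar>measure \<mu>\<^sub>1 A - measure \<mu>\<^sub>2 A\<bar>)"

lemma tilted_in_prob_algebra_iff:
  assumes "\<mu> \<in> space (prob_algebra M)" and "\<Phi> \<in> L0 M UNIV"
  shows "tilted \<mu> \<Phi> \<in> space (prob_algebra M) \<longleftrightarrow> 0 < Z \<Phi> \<mu> \<and> Z \<Phi> \<mu> < \<infinity>"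
proof -
  have s: "sets \<mu> = sets M" using assms(1) by (simp add: space_prob_algebra)
  have m [measurable]: "\<Phi> \<in> borel_measurable \<mu>"
    using assms(2) measurable_cong_sets[OF s refl] by (auto simp: L0_def)
  have e: "emeasure (tilted \<mu> \<Phi>) (space (tilted \<mu> \<Phi>)) = Z \<Phi> \<mu> / Z \<Phi> \<mu>"
    unfolding tilted_def
    by (simp add: emeasure_density nn_integral_divide Z_def cong: nn_integral_cong)
  have "Z \<Phi> \<mu> / Z \<Phi> \<mu> = 1 \<longleftrightarrow> 0 < Z \<Phi> \<mu> \<and> Z \<Phi> \<mu> < \<infinity>"
    by (cases "Z \<Phi> \<mu> = 0"; cases "Z \<Phi> \<mu> = \<infinity>")
       (auto simp: ennreal_divide_self less_top zero_less_iff_neq_zero)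
  moreover have "prob_space (tilted \<mu> \<Phi>) \<longleftrightarrow> Z \<Phi> \<mu> / Z \<Phi> \<mu> = 1"
    using e by (metis prob_space.emeasure_space_1 prob_spaceI)
  moreover have "sets (tilted \<mu> \<Phi>) = sets M" by (simp add: tilted_def s)
  ultimately show ?thesis by (simp add: space_prob_algebra)
qed

end

theory Submission imports Defs begin

text \<open>
  Writing $u_i = -\Phi_i - \log Z_i$, the densities of the tilted measures are $e^{u_i}$, and
  $u_2 - u_1 = \Phi_1 - \Phi_2 + \log (Z_1/Z_2)$.  Both bounds follow by integrating
  $\min(e^{u_1}, e^{u_2}) |u_1 - u_2| \le |e^{u_1} - e^{u_2}| \le \max(e^{u_1}, e^{u_2}) |u_1 - u_2|$,
  since $e^{u_i} \le 1/Z_i$ if $\Phi_i \ge 0$, and $e^{u_i} \ge e^{-\|\Phi_i\|_\infty}/Z_i$ a.s.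
  If $\Phi_1 - \Phi_2$ is a.s. constant, then $u_1 = u_2$ a.s., so that all quantities vanish.
\<close>

text \<open>By symmetry let x be the smaller point. The convex graph of \<open>exp\<close> lies
  above its tangent at y: scale \<open>1 + t \<le> exp t\<close> at \<open>t = x - y\<close> by
  \<open>exp y\<close>.\<close>

lemma abs_exp_diff_le:
  fixes x y :: real
  shows "\<bar>exp x - exp y\<bar> \<le> max (exp x) (exp y) * \<bar>x - y\<bar>"
proof (induction x y rule: linorder_wlog)
  case (le x y)
  have "exp y * (1 - (y - x)) \<le> exp y * exp (x - y)"
    using exp_ge_add_one_self[of "x - y"] by (intro mult_left_mono) (auto simp: algebra_simps)
  also have "\<dots> = exp x"
    by (simp flip: exp_add)
  finally show ?case
    using le by (simp add: max_def algebra_simps)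
qed (simp add: abs_minus_commute max.commute)

text \<open>Same convexity argument with the tangent taken at the smaller of the two points, which
  yields the minimum instead of the maximum.\<close>

lemma abs_exp_diff_ge:
  fixes x y :: real
  shows "min (exp x) (exp y) * \<bar>x - y\<bar> \<le> \<bar>exp x - exp y\<bar>"
proof (induction x y rule: linorder_wlog)
  case (le x y)
  have "exp x * (1 + (y - x)) \<le> exp x * exp (y - x)"
    using exp_ge_add_one_self[of "y - x"] by (intro mult_left_mono) auto
  also have "\<dots> = exp y"
    by (simp flip: exp_add)
  finally show ?case
    using le by (simp add: min_def algebra_simps)
qed (simp add: abs_minus_commute min.commute)

text \<open>If the norm is infinite, both sides are 0: \<open>enn2real\<close> sends infinity to 0,
  and so does the Bochner integral of a non-integrable function.\<close>

lemma enn2real_L1_norm: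
  assumes "f \<in> borel_measurable M"
  shows "enn2real (L1_norm M f) = (LINT x|M. \<bar>f x\<bar>)"
  unfolding L1_norm_def using assms by (subst integral_eq_nn_integral) auto

lemma integrable_if_L1:
  assumes "f \<in> L1 M I"
  shows "integrable M f"
  using assms by (auto simp: L1_def L0_def L1_norm_def integrable_iff_bounded)

lemma AE_abs_le_Linf_norm:
  assumes "f \<in> Linf M I"
  shows "AE x in M. \<bar>f x\<bar> \<le> enn2real (Linf_norm M f)"
proof -
  have fin: "Linf_norm M f < \<infinity>" and [measurable]: "f \<in> borel_measurable M"
    using assms by (auto simp: Linf_def L0_def)
  have "AE x in M. ennreal \<bar>f x\<bar> \<le> Linf_norm M f"
    unfolding Linf_norm_def by (rule esssup_AE)
  then show ?thesis
  proof eventually_elim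
    case (elim x)
    then show ?case
      using enn2real_mono[OF elim] fin by simp
  qed
qed

lemma integrable_if_Linf:
  assumes "finite_measure M" and "f \<in> Linf M I"
  shows "integrable M f"
  using assms(2) AE_abs_le_Linf_norm[OF assms(2)]
  by (intro finite_measure.integrable_const_bound[OF assms(1), of _ "enn2real (Linf_norm M f)"])
     (auto simp: Linf_def L0_def)

text \<open>As g has integral zero, twice its integral over A is the integral of g times a sign, +1
  on A and -1 off A. Such a sign does not change the absolute value of the integrand.\<close>

lemma abs_set_integral_le_half:
  fixes g :: "'a \<Rightarrow> real"
  assumes [simp]: "integrable M g" and zero: "integral\<^sup>L M g = 0" and [measurable]: "A \<in> sets M"
  shows "\<bar>LINT x:A|M. g x\<bar> \<le> 1 / 2 * (LINT x|M. \<bar>g x\<bar>)"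
proof -
  have [simp]: "integrable M (\<lambda>x. indicator A x * g x)"
    using integrable_mult_indicator[of A M g] by simp
  have "2 * (LINT x:A|M. g x) = (LINT x|M. 2 * (indicator A x * g x) - g x)"
    using zero by (simp add: set_lebesgue_integral_def)
  also have "\<bar>\<dots>\<bar> \<le> (LINT x|M. \<bar>2 * (indicator A x * g x) - g x\<bar>)"
    by (rule integral_abs_bound)
  also have "\<dots> = (LINT x|M. \<bar>g x\<bar>)"
    by (intro Bochner_Integration.integral_cong) (auto simp: indicator_def)
  finally show ?thesis
    by simp
qed

text \<open>The positive part of g is \<open>(\<bar>g x\<bar> + g x) / 2\<close>, and its second
  summand integrates to zero. Hence the bound of \<open>abs_set_integral_le_half\<close> is
  attained.\<close>

lemma set_integral_nonneg_part_eq_half: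
  fixes g :: "'a \<Rightarrow> real"
  assumes [simp]: "integrable M g" and zero: "integral\<^sup>L M g = 0"
  shows "(LINT x:{x \<in> space M. 0 \<le> g x}|M. g x) = 1 / 2 * (LINT x|M. \<bar>g x\<bar>)"
proof -
  have "(LINT x:{x \<in> space M. 0 \<le> g x}|M. g x) = (LINT x|M. (\<bar>g x\<bar> + g x) / 2)"
    unfolding set_lebesgue_integral_def
    by (intro Bochner_Integration.integral_cong) (auto simp: indicator_def)
  also have "\<dots> = 1 / 2 * (LINT x|M. \<bar>g x\<bar>)"
    using zero by simp
  finally show ?thesis .
qed

lemma measure_density_integral:
  fixes f :: "'a \<Rightarrow> real"
  assumes [simp]: "integrable M f" and nonneg: "\<And>x. 0 \<le> f x" and [measurable]: "A \<in> sets M"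
  shows "measure (density M (\<lambda>x. ennreal (f x))) A = (LINT x:A|M. f x)"
proof -
  have "emeasure (density M (\<lambda>x. ennreal (f x))) A = (\<integral>\<^sup>+x. ennreal (indicator A x * f x) \<partial>M)"
    using borel_measurable_integrable[OF assms(1)]
    by (subst emeasure_density) (auto intro!: nn_integral_cong simp: indicator_def)
  then show ?thesis
    using nonneg borel_measurable_integrable[OF assms(1)]
    by (simp add: measure_def set_lebesgue_integral_def integral_eq_nn_integral)
qed

text \<open>Equal masses make the difference of the densities integrate to zero, so the two
  preceding bounds on set integrals determine the supremum.\<close>

lemma d_TV_density:
  fixes f g :: "'a \<Rightarrow> real"
  assumes f: "integrable M f" "\<And>x. 0 \<le> f x" and g: "integrable M g" "\<And>x. 0 \<le> g x"
    and mass: "integral\<^sup>L M f = integral\<^sup>L M g"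
  shows "d_TV (density M (\<lambda>x. ennreal (f x))) (density M (\<lambda>x. ennreal (g x)))
    = 1 / 2 * (LINT x|M. \<bar>f x - g x\<bar>)"
proof -
  define h where "h x = f x - g x" for x
  have h: "integrable M h" "integral\<^sup>L M h = 0"
    using f g mass by (simp_all add: h_def[abs_def])
  have diff: "measure (density M (\<lambda>x. ennreal (f x))) A - measure (density M (\<lambda>x. ennreal (g x))) A
      = (LINT x:A|M. h x)" if "A \<in> sets M" for A
    using that f g integrable_mult_indicator[OF that f(1)] integrable_mult_indicator[OF that g(1)]
    by (simp add: measure_density_integral h_def set_integral_diff set_integrable_def)
  have pos: "{x \<in> space M. 0 \<le> h x} \<in> sets M"
    using borel_measurable_integrable[OF h(1)] by measurable
  have "(SUP A\<in>sets M. \<bar>LINT x:A|M. h x\<bar>) = 1 / 2 * (LINT x|M. \<bar>h x\<bar>)"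
  \<comment> \<open>The supremum is a maximum, attained at the set where f is at least g.\<close>
  proof (rule cSup_eq_maximum)
    show "1 / 2 * (LINT x|M. \<bar>h x\<bar>) \<in> (\<lambda>A. \<bar>LINT x:A|M. h x\<bar>) ` sets M"
      using pos by (intro image_eqI[of _ _ "{x \<in> space M. 0 \<le> h x}"])
        (simp_all add: set_integral_nonneg_part_eq_half[OF h] abs_mult)
  qed (use abs_set_integral_le_half[OF h] in auto)
  then show ?thesis
    by (simp add: d_TV_def diff h_def cong: SUP_cong_simp)
qed

text \<open>Moving the normalising constant into the exponent makes the density a pure exponential,
  so that the inequalities for differences of exponentials apply.\<close>

lemma tilted_eq_density_exp:
  assumes [measurable]: "\<Phi> \<in> borel_measurable \<mu>" and "0 < Z \<Phi> \<mu>" "Z \<Phi> \<mu> < \<infinity>"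
  defines "u \<equiv> \<lambda>x. - \<Phi> x - ln (enn2real (Z \<Phi> \<mu>))"
  shows "tilted \<mu> \<Phi> = density \<mu> (\<lambda>x. ennreal (exp (u x)))"
    and "has_bochner_integral \<mu> (\<lambda>x. exp (u x)) 1"
proof -
  have pos: "0 < enn2real (Z \<Phi> \<mu>)"
    using assms(2,3) by (simp add: enn2real_positive_iff)
  have eq: "ennreal (exp (- \<Phi> x)) / Z \<Phi> \<mu> = ennreal (exp (u x))" for x
  proof -
    have "exp (u x) = exp (- \<Phi> x) / enn2real (Z \<Phi> \<mu>)"
      using pos by (simp add: u_def exp_diff)
    then show ?thesis
      using pos assms(3) by (simp flip: divide_ennreal)
  qed
  then show "tilted \<mu> \<Phi> = density \<mu> (\<lambda>x. ennreal (exp (u x)))"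
    by (simp add: tilted_def)
  have "(\<integral>\<^sup>+x. ennreal (exp (u x)) \<partial>\<mu>) = Z \<Phi> \<mu> / Z \<Phi> \<mu>"
    unfolding eq[symmetric] by (simp add: nn_integral_divide Z_def)
  \<comment> \<open>Cancelling in \<open>ennreal\<close> requires \<open>Z \<Phi> \<mu>\<close> to
    be neither 0 nor infinite.\<close>
  also have "\<dots> = ennreal 1"
    using assms(2,3) by (simp add: ennreal_divide_self)
  finally show "has_bochner_integral \<mu> (\<lambda>x. exp (u x)) 1"
    by (intro has_bochner_integral_nn_integral) (simp_all add: u_def)
qed

theorem proposition3p2:
  fixes \<Theta> \<mu> :: "'a measure" and \<Phi>\<^sub>1 \<Phi>\<^sub>2 :: "'a \<Rightarrow> real"
  assumes "\<mu> \<in> space (prob_algebra \<Theta>)"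
    and "\<Phi>\<^sub>1 \<in> L0 \<Theta> UNIV" and "\<Phi>\<^sub>2 \<in> L0 \<Theta> UNIV"
    and "0 < Z \<Phi>\<^sub>1 \<mu>" and "Z \<Phi>\<^sub>1 \<mu> < \<infinity>"
    and "0 < Z \<Phi>\<^sub>2 \<mu>" and "Z \<Phi>\<^sub>2 \<mu> < \<infinity>"
  shows "let Z\<^sub>1 = enn2real (Z \<Phi>\<^sub>1 \<mu>);
             Z\<^sub>2 = enn2real (Z \<Phi>\<^sub>2 \<mu>);
             TV = d_TV (tilted \<mu> \<Phi>\<^sub>1) (tilted \<mu> \<Phi>\<^sub>2);
             N = enn2real (L1_norm \<mu> (\<lambda>x. \<Phi>\<^sub>1 x - \<Phi>\<^sub>2 x + ln (Z\<^sub>1 / Z\<^sub>2)));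
             upper = 1 / 2 * (1 / min Z\<^sub>1 Z\<^sub>2) * N;
             lower = 1 / 2 * min (exp (- enn2real (Linf_norm \<mu> \<Phi>\<^sub>1)) / Z\<^sub>1)
                                 (exp (- enn2real (Linf_norm \<mu> \<Phi>\<^sub>2)) / Z\<^sub>2) * N;
             hyp_i = (\<Phi>\<^sub>1 \<in> L1 \<mu> {0..} \<and> \<Phi>\<^sub>2 \<in> L1 \<mu> {0..});
             hyp_ii = (\<Phi>\<^sub>1 \<in> Linf \<mu> UNIV \<and> \<Phi>\<^sub>2 \<in> Linf \<mu> UNIV)
         in (hyp_i \<longrightarrow> TV \<le> upper)
          \<and> (hyp_ii \<longrightarrow> TV \<ge> lower)
          \<and> ((\<exists>c::real. AE x in \<mu>. \<Phi>\<^sub>1 x - \<Phi>\<^sub>2 x = c) \<longrightarrow>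
               (hyp_i \<longrightarrow> TV = upper) \<and> (hyp_ii \<longrightarrow> TV = lower))"
proof -
  define Z\<^sub>1 Z\<^sub>2 where Z12_def: "Z\<^sub>1 = enn2real (Z \<Phi>\<^sub>1 \<mu>)" "Z\<^sub>2 = enn2real (Z \<Phi>\<^sub>2 \<mu>)"
  define u\<^sub>1 u\<^sub>2 where u_def: "u\<^sub>1 = (\<lambda>x. - \<Phi>\<^sub>1 x - ln Z\<^sub>1)" "u\<^sub>2 = (\<lambda>x. - \<Phi>\<^sub>2 x - ln Z\<^sub>2)"
  define TV where "TV = d_TV (tilted \<mu> \<Phi>\<^sub>1) (tilted \<mu> \<Phi>\<^sub>2)"
  define N where "N = enn2real (L1_norm \<mu> (\<lambda>x. \<Phi>\<^sub>1 x - \<Phi>\<^sub>2 x + ln (Z\<^sub>1 / Z\<^sub>2)))"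
  interpret prob_space \<mu>
    using assms(1) by (simp add: space_prob_algebra)
  have "sets \<mu> = sets \<Theta>"
    using assms(1) by (simp add: space_prob_algebra)
  then have [measurable]: "\<Phi>\<^sub>1 \<in> borel_measurable \<mu>" "\<Phi>\<^sub>2 \<in> borel_measurable \<mu>"
    using assms(2,3) measurable_cong_sets[of \<mu> \<Theta>] by (auto simp: L0_def)
  have Zpos: "0 < Z\<^sub>1" "0 < Z\<^sub>2"
    using assms(4-7) by (simp_all add: Z12_def enn2real_positive_iff)
  have tilted: "tilted \<mu> \<Phi>\<^sub>1 = density \<mu> (\<lambda>x. ennreal (exp (u\<^sub>1 x)))"
      "tilted \<mu> \<Phi>\<^sub>2 = density \<mu> (\<lambda>x. ennreal (exp (u\<^sub>2 x)))"
    and density: "has_bochner_integral \<mu> (\<lambda>x. exp (u\<^sub>1 x)) 1"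
      "has_bochner_integral \<mu> (\<lambda>x. exp (u\<^sub>2 x)) 1"
    using tilted_eq_density_exp[of \<Phi>\<^sub>1 \<mu>] tilted_eq_density_exp[of \<Phi>\<^sub>2 \<mu>] assms(4-7)
    by (simp_all add: u_def Z12_def)
  have TV: "TV = 1 / 2 * (LINT x|\<mu>. \<bar>exp (u\<^sub>1 x) - exp (u\<^sub>2 x)\<bar>)"
    unfolding TV_def tilted using density
    by (intro d_TV_density) (auto simp: has_bochner_integral_iff)
  have u_diff: "\<Phi>\<^sub>1 x - \<Phi>\<^sub>2 x + ln (Z\<^sub>1 / Z\<^sub>2) = u\<^sub>2 x - u\<^sub>1 x" for x
    using Zpos by (simp add: u_def ln_div)
  have N: "N = (LINT x|\<mu>. \<bar>u\<^sub>1 x - u\<^sub>2 x\<bar>)"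
    unfolding N_def u_diff
    by (subst enn2real_L1_norm) (auto simp: u_def abs_minus_commute)
  have int_exp: "integrable \<mu> (\<lambda>x. \<bar>exp (u\<^sub>1 x) - exp (u\<^sub>2 x)\<bar>)"
    using density by (auto simp: has_bochner_integral_iff)
  have int_u: "integrable \<mu> (\<lambda>x. \<bar>u\<^sub>1 x - u\<^sub>2 x\<bar>)" if "integrable \<mu> \<Phi>\<^sub>1" "integrable \<mu> \<Phi>\<^sub>2"
    using that by (simp add: u_def)
  have exp_u: "exp (u\<^sub>1 x) = exp (- \<Phi>\<^sub>1 x) / Z\<^sub>1" "exp (u\<^sub>2 x) = exp (- \<Phi>\<^sub>2 x) / Z\<^sub>2" for x
    using Zpos by (simp_all add: u_def exp_diff)

  have upper: "TV \<le> 1 / 2 * (1 / min Z\<^sub>1 Z\<^sub>2) * N" if "\<Phi>\<^sub>1 \<in> L1 \<mu> {0..}" "\<Phi>\<^sub>2 \<in> L1 \<mu> {0..}"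
  proof -
    have "(LINT x|\<mu>. \<bar>exp (u\<^sub>1 x) - exp (u\<^sub>2 x)\<bar>) \<le> (LINT x|\<mu>. 1 / min Z\<^sub>1 Z\<^sub>2 * \<bar>u\<^sub>1 x - u\<^sub>2 x\<bar>)"
    proof (rule integral_mono)
      fix x assume "x \<in> space \<mu>"
      then have "0 \<le> \<Phi>\<^sub>1 x" "0 \<le> \<Phi>\<^sub>2 x"
        using that by (auto simp: L1_def L0_def)
      \<comment> \<open>Here \<open>exp (- \<Phi>\<^sub>i x)\<close> is at most 1, and the smaller
        normalising constant gives the weaker of the two bounds.\<close>
      then have "max (exp (u\<^sub>1 x)) (exp (u\<^sub>2 x)) \<le> 1 / min Z\<^sub>1 Z\<^sub>2"
        unfolding exp_u using Zpos by (auto intro!: frac_le)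
      then show "\<bar>exp (u\<^sub>1 x) - exp (u\<^sub>2 x)\<bar> \<le> 1 / min Z\<^sub>1 Z\<^sub>2 * \<bar>u\<^sub>1 x - u\<^sub>2 x\<bar>"
        by (intro order_trans[OF abs_exp_diff_le] mult_right_mono) auto
    qed (intro int_exp integrable_mult_right int_u integrable_if_L1[OF that(1)] integrable_if_L1[OF that(2)])+
    then show ?thesis
      by (simp add: TV N)
  qed

  have lower: "TV \<ge> 1 / 2 * min (exp (- enn2real (Linf_norm \<mu> \<Phi>\<^sub>1)) / Z\<^sub>1)
      (exp (- enn2real (Linf_norm \<mu> \<Phi>\<^sub>2)) / Z\<^sub>2) * N" (is "TV \<ge> 1 / 2 * ?m * N")
    if "\<Phi>\<^sub>1 \<in> Linf \<mu> UNIV" "\<Phi>\<^sub>2 \<in> Linf \<mu> UNIV"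
  proof -
    have "(LINT x|\<mu>. ?m * \<bar>u\<^sub>1 x - u\<^sub>2 x\<bar>) \<le> (LINT x|\<mu>. \<bar>exp (u\<^sub>1 x) - exp (u\<^sub>2 x)\<bar>)"
    \<comment> \<open>The comparison is only almost everywhere, because an essential supremum bounds
      a function only up to a null set.\<close>
    proof (rule integral_mono_AE)
      show "AE x in \<mu>. ?m * \<bar>u\<^sub>1 x - u\<^sub>2 x\<bar> \<le> \<bar>exp (u\<^sub>1 x) - exp (u\<^sub>2 x)\<bar>"
        using AE_abs_le_Linf_norm[OF that(1)] AE_abs_le_Linf_norm[OF that(2)]
      proof eventually_elim
        case (elim x)
        have "?m \<le> min (exp (u\<^sub>1 x)) (exp (u\<^sub>2 x))"
          unfolding exp_u using Zpos elim by (intro min.mono divide_right_mono) auto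
        then show ?case
          by (intro order_trans[OF _ abs_exp_diff_ge] mult_right_mono) auto
      qed
    qed (use int_exp int_u that in \<open>auto intro: integrable_if_Linf finite_measure_axioms\<close>)
    then show ?thesis
      by (simp add: TV N)
  qed

  have const: "TV = 0 \<and> N = 0" if "AE x in \<mu>. \<Phi>\<^sub>1 x - \<Phi>\<^sub>2 x = c" for c
  proof -
    \<comment> \<open>Substituting \<open>\<Phi>\<^sub>1 x = \<Phi>\<^sub>2 x + c\<close> into
      \<open>u\<^sub>1\<close> leaves exactly this offset from \<open>u\<^sub>2\<close>.\<close>
    define d where "d = - c - ln Z\<^sub>1 + ln Z\<^sub>2"
    have ae: "AE x in \<mu>. u\<^sub>1 x = u\<^sub>2 x + d"
      using that by eventually_elim (simp add: u_def d_def)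
    \<comment> \<open>Both densities have total mass 1, so comparing their integrals forces
      \<open>exp d = 1\<close>.\<close>
    have "(LINT x|\<mu>. exp (u\<^sub>1 x)) = (LINT x|\<mu>. exp d * exp (u\<^sub>2 x))"
      using ae by (intro integral_cong_AE) (auto simp: u_def exp_add elim!: eventually_mono)
    then have "d = 0"
      using density by (simp add: has_bochner_integral_iff)
    then have "AE x in \<mu>. u\<^sub>1 x = u\<^sub>2 x"
      using ae by simp
    then show ?thesis
      unfolding TV N by (simp add: integral_eq_zero_AE)
  qed

  \<comment> \<open>In the equality case both bounds are multiples of \<open>N = 0\<close>, so they
    agree with \<open>TV = 0\<close>.\<close>
  show ?thesis
    unfolding Let_def Z12_def[symmetric] TV_def[symmetric] N_def[symmetric]
    using upper lower const by auto
qed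

end
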